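(* Let $q$ be a prime power and let $d \ge 2$ be a divisor of $q-1$. Let $EA(q) \rtimes C_d$ denote the subgroup of $\mathrm{Aff}(q)$ consisting of the maps $x \mapsto ax + b$ with $b \in GF(q)$ and $a$ in the unique subgroup of order $d$ of $GF(q)^*$. Then $EA(q) \rtimes C_d$ contains a $(qd, 2q-1, \frac{4(q-1)}{d})$ sum set.
   Context: $\mathrm{Aff}(q)$ is the group, under composition, of all maps $GF(q)\to GF(q)$ of the form $x \mapsto ax + b$ with $a \in GF(q)^*$, $b \in GF(q)$. For a finite group $X$ of order $w$, $T\subseteq X$ with $|T|=k$ is a $(w,k,\mu)$ sum set if every nonidentity element $a\in X$ admits exactly $\mu$ ordered pairs $(y_1,y_2)\in T\times T$ with $y_1y_2 = a$. *)

theory Defs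
  imports
    "HOL-Algebra.Bij"
    "HOL-Algebra.Multiplicative_Group"
    "HOL-Number_Theory.Prime_Powers"
begin

definition sum_set :: "('a, 'b) monoid_scheme \<Rightarrow> nat \<Rightarrow> nat \<Rightarrow> nat \<Rightarrow> 'a set \<Rightarrow> bool" where
  "sum_set X w k \<mu> T \<longleftrightarrow>
     group X \<and> finite (carrier X) \<and> order X = w \<and>
     T \<subseteq> carrier X \<and> card T = k \<and>
     (\<forall>a \<in> carrier X - {\<one>\<^bsub>X\<^esub>}.
        card {(y1, y2). y1 \<in> T \<and> y2 \<in> T \<and> y1 \<otimes>\<^bsub>X\<^esub> y2 = a} = \<mu>)"

text \<open>
  Self-maps of the field are represented as extensional functions on its carrier, so that
  equality of maps is equality of functions; the group operation inherited from
  \<^const>\<open>BijGroup\<close> is composition, \<open>(g \<otimes> f) x = g (f x)\<close>.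
\<close>

definition affine_map :: "('a, 'b) ring_scheme \<Rightarrow> 'a \<Rightarrow> 'a \<Rightarrow> 'a \<Rightarrow> 'a" where
  "affine_map F a b = (\<lambda>x \<in> carrier F. (a \<otimes>\<^bsub>F\<^esub> x) \<oplus>\<^bsub>F\<^esub> b)"

definition Aff :: "('a, 'b) ring_scheme \<Rightarrow> ('a \<Rightarrow> 'a) monoid" where
  "Aff F = BijGroup (carrier F)
     \<lparr>carrier := {affine_map F a b | a b. a \<in> carrier (mult_of F) \<and> b \<in> carrier F}\<rparr>"

text \<open>
  The definite description below is meaningful when \<open>F\<close> is a finite field and \<open>d\<close> divides the
  order of its (cyclic) multiplicative group.
\<close>

definition mult_subgroup :: "('a, 'b) ring_scheme \<Rightarrow> nat \<Rightarrow> 'a set" where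
  "mult_subgroup F d = (THE C. subgroup C (mult_of F) \<and> card C = d)"

definition EA_semidirect_C :: "('a, 'b) ring_scheme \<Rightarrow> nat \<Rightarrow> ('a \<Rightarrow> 'a) monoid" where
  "EA_semidirect_C F d = Aff F
     \<lparr>carrier := {affine_map F a b | a b. a \<in> mult_subgroup F d \<and> b \<in> carrier F}\<rparr>"

end

theory Submission
  imports Defs
begin

text \<open>
  Let \<open>C\<close> be the subgroup of order \<open>d\<close> of the multiplicative group, \<open>m = (q - 1) / d\<close> its index,
  and let \<open>A\<close> contain exactly two elements of every coset of \<open>C\<close>. Let \<open>S\<close> be the set of all maps
  \<open>x \<mapsto> c x + u\<close> with \<open>c \<in> C\<close> and \<open>u \<in> A\<close>. Every nonzero field element is \<open>c v\<close> for
  exactly two pairs \<open>(c, v) \<in> C \<times> A\<close>, so in the group ring \<open>S\<^sup>2 = 4 m G - 2 S\<close>, and hence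
  \<open>T = {1} \<union> S\<close> satisfies \<open>T\<^sup>2 = 1 + 4 m G\<close>.
\<close>

section \<open>Sets meeting every coset equally often\<close>

text \<open>Right cosets are pairwise disjoint and all have \<open>card H\<close> elements, so when
  \<open>n\<close> is at most \<open>card H\<close> one may pick \<open>n\<close> elements from each
  coset independently and take the union. For \<open>n = 1\<close> this is an ordinary transversal;
  the construction uses \<open>n = 2\<close>.\<close>

lemma (in group) ex_multi_transversal:
  assumes fin: "finite (carrier G)" and H: "subgroup H G" and n: "n \<le> card H"
  shows "\<exists>A \<subseteq> carrier G. card A = n * card (rcosets H) \<and>
           (\<forall>x \<in> carrier G. card (A \<inter> (H #> x)) = n)"
proof -
  have "\<forall>K \<in> rcosets H. \<exists>B. B \<subseteq> K \<and> card B = n"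
    using n card_rcosets_equal subgroup.subset[OF H] by (metis obtain_subset_with_card_n)
  then obtain f where f: "\<And>K. K \<in> rcosets H \<Longrightarrow> f K \<subseteq> K \<and> card (f K) = n"
    by metis
  define A where "A = (\<Union>K \<in> rcosets H. f K)"
  have disj: "K \<inter> L = {}" if "K \<in> rcosets H" "L \<in> rcosets H" "K \<noteq> L" for K L
    using rcos_disjoint[OF H] that by (auto simp: pairwise_def disjnt_def)
  have sub: "K \<subseteq> carrier G" if "K \<in> rcosets H" for K
    using rcosets_part_G[OF H] that by blast
  have finR: "finite (rcosets H)"
    using fin rcosets_part_G[OF H] by (metis finite_UnionD)
  have "card A = (\<Sum>K \<in> rcosets H. card (f K))"
    unfolding A_def
  proof (rule card_UN_disjoint[OF finR])
    show "\<forall>K \<in> rcosets H. finite (f K)"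
      using f sub fin by (meson finite_subset)
    show "\<forall>K \<in> rcosets H. \<forall>L \<in> rcosets H. K \<noteq> L \<longrightarrow> f K \<inter> f L = {}"
      using f disj by (meson disjoint_iff subsetD)
  qed
  then have "card A = n * card (rcosets H)"
    using f by simp
  moreover have "card (A \<inter> (H #> x)) = n" if "x \<in> carrier G" for x
  proof -
    have K: "H #> x \<in> rcosets H"
      using that by (auto simp: RCOSETS_def)
    have "A \<inter> (H #> x) = f (H #> x)"
    proof
      show "A \<inter> (H #> x) \<subseteq> f (H #> x)"
      proof
        fix y assume "y \<in> A \<inter> (H #> x)"
        then obtain L where "L \<in> rcosets H" "y \<in> f L" "y \<in> H #> x"
          by (auto simp: A_def)
        then show "y \<in> f (H #> x)"
          using f[of L] disj[of L "H #> x"] K by auto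
      qed
    qed (use f[OF K] K in \<open>auto simp: A_def\<close>)
    then show ?thesis
      using f[OF K] by simp
  qed
  moreover have "A \<subseteq> carrier G"
    using f sub by (fastforce simp: A_def)
  ultimately show ?thesis
    by blast
qed

context field
begin

section \<open>The subgroup of order d of the multiplicative group\<close>

text \<open>This discharges the definite description in \<open>mult_subgroup\<close>. Existence
  comes from a generator of the cyclic multiplicative group, uniqueness from the bound on the number
  of roots of \<open>x^d - 1\<close>.\<close>

lemma mult_subgroup_char:
  assumes fin: "finite (carrier R)" and d: "d > 0" and dvd: "d dvd order R - 1"
  shows "subgroup (mult_subgroup R d) (mult_of R)" and "card (mult_subgroup R d) = d"
proof -
  interpret M: group "mult_of R"
    by (rule field_mult_group)
  have finM: "finite (carrier (mult_of R))"
    using fin by simp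
  have ord: "order (mult_of R) = order R - 1"
    by (rule order_mult_of[OF fin])
  obtain g where g: "g \<in> carrier (mult_of R)"
    and gen: "carrier (mult_of R) = {g [^] i | i::nat. i \<in> UNIV}"
    using finite_field_mult_group_has_gen[OF fin] by blast
  have "generate (mult_of R) {g} = carrier (mult_of R)"
    using M.generate_pow_on_finite_carrier[OF finM g] gen by (simp add: nat_pow_mult_of)
  then have ordg: "M.ord g = order R - 1"
    using M.generate_pow_card[OF g] ord by (simp add: order_def)
  obtain k where k: "order R - 1 = d * k"
    using dvd by blast
  have "order (mult_of R) > 0"
    using M.order_gt_0_iff_finite finM by blast
  then have k0: "k \<noteq> 0"
    using k ord by (metis mult_0_right less_numeral_extra(3))
  \<comment> \<open>The generator \<open>g\<close> has order \<open>d * k\<close>, so its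
    \<open>k\<close>-th power has order \<open>d\<close> and generates a subgroup of that
    size.\<close>
  define h where "h = g [^]\<^bsub>mult_of R\<^esub> k"
  have h: "h \<in> carrier (mult_of R)"
    unfolding h_def using g by (rule M.nat_pow_closed)
  have "M.ord h = d"
    unfolding h_def using M.ord_pow[OF g, of k] ordg k k0 by simp
  then have ex: "subgroup (generate (mult_of R) {h}) (mult_of R) \<and> card (generate (mult_of R) {h}) = d"
    using M.generate_is_subgroup[of "{h}"] M.generate_pow_card[OF h] h by simp
  \<comment> \<open>A subgroup of order \<open>d\<close> lies in this root set by Lagrange, and the
    root set has at most \<open>d\<close> elements, so the two coincide. The right-hand side does
    not mention \<open>C\<close>, which gives uniqueness.\<close>
  let ?Z = "{x \<in> carrier R. x [^] d = \<one>}"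
  have uniq: "C = ?Z" if C: "subgroup C (mult_of R)" "card C = d" for C
  proof -
    have "x [^] d = \<one>" if x: "x \<in> C" for x
    proof -
      have "x [^]\<^bsub>mult_of R\<lparr>carrier := C\<rparr>\<^esub> d = \<one>\<^bsub>mult_of R\<lparr>carrier := C\<rparr>\<^esub>"
        using group.pow_order_eq_1[OF M.subgroup_imp_group[OF C(1)], of x] x C(2)
        by (simp add: order_def)
      then show ?thesis
        by (simp add: M.nat_pow_consistent[symmetric] nat_pow_mult_of)
    qed
    then have "C \<subseteq> ?Z"
      using subgroup.subset[OF C(1)] by auto
    moreover have "card ?Z \<le> card C"
      using num_roots_le_deg[OF fin] d C(2) by simp
    ultimately show ?thesis
      using fin by (intro card_seteq) auto
  qed
  have "\<exists>!C. subgroup C (mult_of R) \<and> card C = d"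
    using ex uniq by metis
  from theI'[OF this]
  show "subgroup (mult_subgroup R d) (mult_of R)" "card (mult_subgroup R d) = d"
    by (auto simp: mult_subgroup_def)
qed

section \<open>Groups of affine maps\<close>

text \<open>The value at zero is \<open>b\<close> and the value at one is \<open>a\<close> plus
  \<open>b\<close>, so the map determines both coefficients. Counting affine maps thus reduces to
  counting coefficient pairs.\<close>

lemma affine_map_eq_iff:
  assumes "a \<in> carrier R" "b \<in> carrier R" "a' \<in> carrier R" "b' \<in> carrier R"
  shows "affine_map R a b = affine_map R a' b' \<longleftrightarrow> a = a' \<and> b = b'"
proof
  assume eq: "affine_map R a b = affine_map R a' b'"
  from fun_cong[OF eq, of \<zero>] have b: "b = b'"
    using assms by (simp add: affine_map_def)
  from fun_cong[OF eq, of \<one>] show "a = a' \<and> b = b'"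
    using assms b by (simp add: affine_map_def)
qed simp

lemma compose_affine_map:
  assumes "a \<in> carrier R" "b \<in> carrier R" "a' \<in> carrier R" "b' \<in> carrier R"
  shows "compose (carrier R) (affine_map R a b) (affine_map R a' b')
           = affine_map R (a \<otimes> a') (a \<otimes> b' \<oplus> b)"
  using assms
  by (intro extensionalityI[where A = "carrier R"])
     (auto simp: compose_def affine_map_def r_distr m_assoc a_assoc)

lemma affine_map_one: "affine_map R \<one> \<zero> = \<one>\<^bsub>BijGroup (carrier R)\<^esub>"
  by (auto simp: affine_map_def BijGroup_def restrict_def fun_eq_iff)

text \<open>Solving \<open>a x + b = y\<close> for \<open>x\<close> gives the coefficients of the
  inverse map. Both compositions are recorded, since bijectivity below needs a two-sided
  inverse.\<close>

lemma affine_map_inverse: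
  assumes a: "a \<in> carrier R - {\<zero>}" and b: "b \<in> carrier R"
  defines "b' \<equiv> \<ominus> (inv a \<otimes> b)"
  shows "compose (carrier R) (affine_map R a b) (affine_map R (inv a) b') = affine_map R \<one> \<zero>"
    and "compose (carrier R) (affine_map R (inv a) b') (affine_map R a b) = affine_map R \<one> \<zero>"
proof -
  have i: "inv a \<in> carrier R" "inv a \<otimes> a = \<one>" "a \<otimes> inv a = \<one>"
    using a field_Units by auto
  have "a \<otimes> b' = \<ominus> b"
    using a b i by (simp add: b'_def r_minus m_assoc[symmetric])
  then show "compose (carrier R) (affine_map R a b) (affine_map R (inv a) b') = affine_map R \<one> \<zero>"
    using a b i by (simp add: compose_affine_map b'_def l_neg)
  show "compose (carrier R) (affine_map R (inv a) b') (affine_map R a b) = affine_map R \<one> \<zero>"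
    using a b i by (simp add: compose_affine_map b'_def r_neg)
qed

lemma affine_map_Bij:
  assumes a: "a \<in> carrier R - {\<zero>}" and b: "b \<in> carrier R"
  shows "affine_map R a b \<in> Bij (carrier R)"
proof -
  let ?f = "affine_map R a b" and ?g = "affine_map R (inv a) (\<ominus> (inv a \<otimes> b))"
  have i: "inv a \<in> carrier R"
    using a field_Units by auto
  have "?f (?g x) = x" if "x \<in> carrier R" for x
    using fun_cong[OF affine_map_inverse(1)[OF a b], of x] that
    by (simp add: compose_eq) (simp add: affine_map_def)
  moreover have "?g (?f x) = x" if "x \<in> carrier R" for x
    using fun_cong[OF affine_map_inverse(2)[OF a b], of x] that
    by (simp add: compose_eq) (simp add: affine_map_def)
  moreover have "?f \<in> carrier R \<rightarrow> carrier R" "?g \<in> carrier R \<rightarrow> carrier R"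
    using a b i by (auto simp: affine_map_def)
  ultimately have "bij_betw ?f (carrier R) (carrier R)"
    by (intro bij_betwI[where g = ?g])
  then show ?thesis
    by (simp add: Bij_def affine_map_def)
qed

lemma mult_affine_map:
  assumes "a \<in> carrier R - {\<zero>}" "b \<in> carrier R" "a' \<in> carrier R - {\<zero>}" "b' \<in> carrier R"
  shows "affine_map R a b \<otimes>\<^bsub>BijGroup (carrier R)\<^esub> affine_map R a' b'
           = affine_map R (a \<otimes> a') (a \<otimes> b' \<oplus> b)"
  using assms by (simp add: BijGroup_def affine_map_Bij compose_affine_map)

text \<open>Under composition the linear parts multiply, so they stay in \<open>C\<close>. The
  ambient group is that of all bijections because \<open>EA_semidirect_C\<close> is this group with
  its carrier cut down, so the group axioms are inherited.\<close>

lemma subgroup_affine_maps: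
  assumes C: "subgroup C (mult_of R)"
  shows "subgroup {affine_map R a b | a b. a \<in> C \<and> b \<in> carrier R} (BijGroup (carrier R))"
    (is "subgroup ?G ?B")
proof -
  interpret B: group ?B
    by (rule group_BijGroup)
  have CR: "a \<in> carrier R - {\<zero>}" if "a \<in> C" for a
    using subgroup.subset[OF C] that by auto
  show ?thesis
  proof (rule B.subgroupI)
    show "?G \<subseteq> carrier ?B"
      using CR affine_map_Bij by (auto simp: BijGroup_def)
    show "?G \<noteq> {}"
      using subgroup.one_closed[OF C] by auto
    show "inv\<^bsub>?B\<^esub> f \<in> ?G" if "f \<in> ?G" for f
    proof -
      obtain a b where f: "f = affine_map R a b" and a: "a \<in> C" and b: "b \<in> carrier R"
        using \<open>f \<in> ?G\<close> by blast
      let ?b = "\<ominus> (inv a \<otimes> b)"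
      have iC: "inv a \<in> C"
        using subgroup.m_inv_closed[OF C a] m_inv_mult_of CR[OF a] by simp
      have b': "?b \<in> carrier R"
        using CR[OF iC] b by simp
      have "affine_map R (inv a) ?b \<otimes>\<^bsub>?B\<^esub> f = \<one>\<^bsub>?B\<^esub>"
        using affine_map_inverse(2)[OF CR[OF a] b] CR[OF a] CR[OF iC] b b'
        unfolding f affine_map_one[symmetric] by (simp add: BijGroup_def affine_map_Bij)
      then have "inv\<^bsub>?B\<^esub> f = affine_map R (inv a) ?b"
        using CR[OF a] CR[OF iC] b b' unfolding f
        by (intro B.inv_equality) (simp_all add: BijGroup_def affine_map_Bij)
      then show ?thesis
        using iC b' by blast
    qed
    show "f \<otimes>\<^bsub>?B\<^esub> g \<in> ?G" if "f \<in> ?G" "g \<in> ?G" for f g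
    proof -
      obtain a b a' b' where fg: "f = affine_map R a b" "g = affine_map R a' b'"
        and C': "a \<in> C" "a' \<in> C" and b: "b \<in> carrier R" "b' \<in> carrier R"
        using \<open>f \<in> ?G\<close> \<open>g \<in> ?G\<close> by blast
      have "f \<otimes>\<^bsub>?B\<^esub> g = affine_map R (a \<otimes> a') (a \<otimes> b' \<oplus> b)"
        using mult_affine_map CR C' b fg by simp
      moreover have "a \<otimes> a' \<in> C"
        using subgroup.m_closed[OF C C'] by simp
      moreover have "a \<otimes> b' \<oplus> b \<in> carrier R"
        using CR C' b by simp
      ultimately show ?thesis
        by blast
    qed
  qed
qed

section \<open>Counting solutions in the field\<close>

text \<open>The equation \<open>c v = z\<close> says that \<open>v\<close> is the inverse of
  \<open>c\<close> times \<open>z\<close>, hence that \<open>v\<close> lies in the coset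
  \<open>C z\<close>; conversely \<open>v\<close>, being nonzero, determines \<open>c\<close>.
  Projection to \<open>v\<close> is therefore a bijection onto the right-hand set.\<close>

lemma card_coset_factorizations:
  assumes C: "subgroup C (mult_of R)"
    and A: "A \<subseteq> carrier R - {\<zero>}"
    and z: "z \<in> carrier R - {\<zero>}"
  shows "card {(c, v). c \<in> C \<and> v \<in> A \<and> c \<otimes> v = z} = card (A \<inter> (C #>\<^bsub>mult_of R\<^esub> z))"
proof -
  let ?F = "{(c, v). c \<in> C \<and> v \<in> A \<and> c \<otimes> v = z}"
  have CR: "c \<in> carrier R - {\<zero>}" if "c \<in> C" for c
    using subgroup.subset[OF C] that by auto
  have iC: "inv c \<in> C" if "c \<in> C" for c
    using subgroup.m_inv_closed[OF C that] m_inv_mult_of CR[OF that] by simp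
  have ii: "inv c \<otimes> c = \<one>" "c \<otimes> inv c = \<one>" if "c \<in> C" for c
    using CR[OF that] field_Units by auto
  have "inj_on snd ?F"
  proof (rule inj_onI, unfold split_paired_all)
    fix c v c' v' assume *: "(c, v) \<in> ?F" "(c', v') \<in> ?F" "snd (c, v) = snd (c', v')"
    then have "v \<in> carrier R" "v \<noteq> \<zero>" "c \<in> carrier R" "c' \<in> carrier R" "c \<otimes> v = c' \<otimes> v"
      using CR A by auto
    then show "(c, v) = (c', v')"
      using * m_rcancel[of v c c'] by simp
  qed
  moreover have "snd ` ?F = A \<inter> (C #>\<^bsub>mult_of R\<^esub> z)"
  proof (rule Set.set_eqI)
    fix v
    \<comment> \<open>The witnesses on the two sides are inverse to each other, and \<open>C\<close>
      is closed under inverses.\<close>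
    have "(\<exists>c \<in> C. c \<otimes> v = z) \<longleftrightarrow> (\<exists>c \<in> C. v = c \<otimes> z)" if "v \<in> A"
    proof
      assume "\<exists>c \<in> C. c \<otimes> v = z"
      then obtain c where c: "c \<in> C" "c \<otimes> v = z"
        by blast
      have "inv c \<otimes> z = v"
        using c ii[OF c(1)] CR[OF c(1)] CR[OF iC[OF c(1)]] A that
        by (auto simp: m_assoc[symmetric])
      then show "\<exists>c \<in> C. v = c \<otimes> z"
        using iC c by blast
    next
      assume "\<exists>c \<in> C. v = c \<otimes> z"
      then obtain c where c: "c \<in> C" "v = c \<otimes> z"
        by blast
      have "inv c \<otimes> v = z"
        using c ii[OF c(1)] CR[OF c(1)] CR[OF iC[OF c(1)]] z
        by (auto simp: m_assoc[symmetric])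
      then show "\<exists>c \<in> C. c \<otimes> v = z"
        using iC c by blast
    qed
    then show "v \<in> snd ` ?F \<longleftrightarrow> v \<in> A \<inter> (C #>\<^bsub>mult_of R\<^esub> z)"
      by (force simp: r_coset_def image_iff)
  qed
  ultimately show ?thesis
    using card_image[of snd ?F] by simp
qed

text \<open>Fix \<open>u\<close>. The pairs \<open>(c, v)\<close> are the factorizations of
  \<open>b - u\<close>: there are \<open>n\<close> of them if \<open>u\<close> differs from
  \<open>b\<close>, and none if \<open>u = b\<close>, because \<open>c v\<close> is never
  zero.\<close>

lemma card_translated_factorizations:
  assumes fin: "finite (carrier R)"
    and C: "subgroup C (mult_of R)"
    and A: "A \<subseteq> carrier R - {\<zero>}"
    and n: "\<And>z. z \<in> carrier R - {\<zero>} \<Longrightarrow> card (A \<inter> (C #>\<^bsub>mult_of R\<^esub> z)) = n"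
    and b: "b \<in> carrier R"
  shows "card {(u, c, v). u \<in> A \<and> c \<in> C \<and> v \<in> A \<and> c \<otimes> v \<oplus> u = b} = n * card (A - {b})"
proof -
  have CR: "c \<in> carrier R - {\<zero>}" if "c \<in> C" for c
    using subgroup.subset[OF C] that by auto
  have finA: "finite A" and finC: "finite C"
    using fin A CR by (auto intro: finite_subset)
  let ?F = "\<lambda>z. {(c, v). c \<in> C \<and> v \<in> A \<and> c \<otimes> v = z}"
  have shift: "c \<otimes> v \<oplus> u = b \<longleftrightarrow> c \<otimes> v = b \<ominus> u" if "c \<in> C" "v \<in> A" "u \<in> A" for c v u
  proof -
    have cl: "c \<otimes> v \<in> carrier R" "u \<in> carrier R"
      using CR A that by auto
    show ?thesis
    proof
      assume "c \<otimes> v \<oplus> u = b"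
      then show "c \<otimes> v = b \<ominus> u"
        using cl b by (auto simp: a_minus_def a_assoc r_neg)
    next
      assume "c \<otimes> v = b \<ominus> u"
      then show "c \<otimes> v \<oplus> u = b"
        using cl b by (simp add: a_minus_def a_assoc l_neg)
    qed
  qed
  have nonzero: "c \<otimes> v \<noteq> \<zero>" if "c \<in> C" "v \<in> A" for c v
    using CR[OF that(1)] A that(2) integral by blast
  have "{(u, c, v). u \<in> A \<and> c \<in> C \<and> v \<in> A \<and> c \<otimes> v \<oplus> u = b} = (SIGMA u:A - {b}. ?F (b \<ominus> u))"
  proof (rule Set.set_eqI, unfold split_paired_all)
    fix u c v
    have "b \<ominus> b = \<zero>"
      using b by (simp add: a_minus_def r_neg)
    then show "(u, c, v) \<in> {(u, c, v). u \<in> A \<and> c \<in> C \<and> v \<in> A \<and> c \<otimes> v \<oplus> u = b} \<longleftrightarrow>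
      (u, c, v) \<in> (SIGMA u:A - {b}. ?F (b \<ominus> u))"
      using shift[of c v u] nonzero[of c v] by (cases "u = b") auto
  qed
  moreover have "card (?F (b \<ominus> u)) = n" if "u \<in> A - {b}" for u
  proof -
    have "b \<ominus> u \<in> carrier R - {\<zero>}"
      using that A b r_right_minus_eq[of b u] by auto
    then show ?thesis
      using card_coset_factorizations[OF C A] n by simp
  qed
  moreover have "finite (?F z)" for z
    by (rule finite_subset[of _ "C \<times> A"]) (use finA finC in auto)
  ultimately show ?thesis
    using finA by simp
qed

section \<open>The sum set property\<close>

text \<open>Let \<open>g\<close> be a nonidentity map with translation part \<open>b\<close>. It has
  \<open>2 * card (A - {b})\<close> factorizations with both factors in \<open>S\<close>. If
  \<open>b\<close> is in \<open>A\<close> this falls short of \<open>2 * card A\<close> by two,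
  which is exactly when \<open>g\<close> is in \<open>S\<close> and the two factorizations with an
  identity factor appear.\<close>

lemma sum_set_affine_maps:
  assumes fin: "finite (carrier R)"
    and C: "subgroup C (mult_of R)"
    and A: "A \<subseteq> carrier R - {\<zero>}"
    and two: "\<And>z. z \<in> carrier R - {\<zero>} \<Longrightarrow> card (A \<inter> (C #>\<^bsub>mult_of R\<^esub> z)) = 2"
  shows "sum_set (BijGroup (carrier R)\<lparr>carrier := {affine_map R a b | a b. a \<in> C \<and> b \<in> carrier R}\<rparr>)
           (order R * card C) (card A * card C + 1) (2 * card A)
           (insert (affine_map R \<one> \<zero>) {affine_map R c u | c u. c \<in> C \<and> u \<in> A})"
proof -
  let ?B = "BijGroup (carrier R)"
  define G where "G = {affine_map R a b | a b. a \<in> C \<and> b \<in> carrier R}"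
  define S where "S = {affine_map R c u | c u. c \<in> C \<and> u \<in> A}"
  define e where "e = affine_map R \<one> \<zero>"
  interpret B: group ?B
    by (rule group_BijGroup)
  have CR: "c \<in> carrier R - {\<zero>}" if "c \<in> C" for c
    using subgroup.subset[OF C] that by auto
  have AR: "u \<in> carrier R" "u \<noteq> \<zero>" if "u \<in> A" for u
    using A that by auto
  have finA: "finite A" and finC: "finite C"
    using fin A CR by (auto intro: finite_subset)
  have oneC: "\<one> \<in> C"
    using subgroup.one_closed[OF C] by simp
  have sG: "subgroup G ?B"
    unfolding G_def by (rule subgroup_affine_maps[OF C])
  \<comment> \<open>The set \<open>X\<close> of translation parts is kept general: the whole field
    gives the order of the group, and \<open>A\<close> gives the size of \<open>S\<close>.\<close>
  have card_aff: "card {affine_map R a b | a b. a \<in> C \<and> b \<in> X} = card X * card C"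
    if "X \<subseteq> carrier R" for X
  proof -
    have "{affine_map R a b | a b. a \<in> C \<and> b \<in> X} = (\<lambda>(a, b). affine_map R a b) ` (C \<times> X)"
      by auto
    moreover have "inj_on (\<lambda>(a, b). affine_map R a b) (C \<times> X)"
      using that CR by (auto simp: inj_on_def affine_map_eq_iff subset_iff)
    ultimately show ?thesis
      by (simp add: card_image card_cartesian_product)
  qed
  have cardG: "card G = order R * card C"
    unfolding G_def order_def by (rule card_aff) simp
  have cardS: "card S = card A * card C"
    unfolding S_def using A by (intro card_aff) auto
  have "G = (\<lambda>(a, b). affine_map R a b) ` (C \<times> carrier R)"
    by (auto simp: G_def)
  then have finG: "finite G"
    using fin finC by simp
  have SG: "S \<subseteq> G"
    using AR by (auto simp: S_def G_def)
  have eG: "e \<in> G"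
    using oneC by (auto simp: e_def G_def)
  have S_iff: "affine_map R a b \<in> S \<longleftrightarrow> b \<in> A" if "a \<in> C" "b \<in> carrier R" for a b
    unfolding S_def using that CR AR by (auto simp: affine_map_eq_iff)
  \<comment> \<open>The identity has translation part zero, and \<open>A\<close> avoids
    zero.\<close>
  have eS: "e \<notin> S"
    using S_iff[OF oneC, of \<zero>] AR by (auto simp: e_def)
  have e_one: "e = \<one>\<^bsub>?B\<^esub>"
    unfolding e_def by (rule affine_map_one)
  have GB: "g \<in> carrier ?B" if "g \<in> G" for g
    using subgroup.subset[OF sG] that by blast
  have count: "card {(y1, y2). y1 \<in> insert e S \<and> y2 \<in> insert e S \<and> y1 \<otimes>\<^bsub>?B\<^esub> y2 = g} = 2 * card A"
    if g: "g \<in> G" "g \<noteq> e" for g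
  proof -
    obtain a b where gab: "g = affine_map R a b" and a: "a \<in> C" and b: "b \<in> carrier R"
      using g by (auto simp: G_def)
    let ?Q = "{(y1, y2). y1 \<in> S \<and> y2 \<in> S \<and> y1 \<otimes>\<^bsub>?B\<^esub> y2 = g}"
    \<comment> \<open>These are the factorizations that involve \<open>e\<close>. The pair
      \<open>(e, e)\<close> is excluded and the two listed pairs are distinct because
      \<open>g\<close> is not \<open>e\<close>.\<close>
    let ?E = "if g \<in> S then {(e, g), (g, e)} else {}"
    let ?W = "{(u, c, v). u \<in> A \<and> c \<in> C \<and> v \<in> A \<and> c \<otimes> v \<oplus> u = b}"
    have split: "{(y1, y2). y1 \<in> insert e S \<and> y2 \<in> insert e S \<and> y1 \<otimes>\<^bsub>?B\<^esub> y2 = g} = ?Q \<union> ?E"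
      using g SG GB by (auto simp: e_one)
    have finQ: "finite ?Q"
      by (rule finite_subset[of _ "G \<times> G"]) (use SG finG in auto)
    have "?Q \<inter> ?E = {}"
      using eS by auto
    then have "card (?Q \<union> ?E) = card ?Q + card ?E"
      using finQ by (intro card_Un_disjoint) auto
    moreover have "card ?E = (if b \<in> A then 2 else 0)"
      using g(2) S_iff[OF a b] gab by auto
    moreover have "card ?Q = 2 * card (A - {b})"
    proof -
      \<comment> \<open>In a product of maps with coefficients \<open>(c, u)\<close> and
        \<open>(c', v)\<close> the linear part is \<open>c c'\<close> and the translation part is
        \<open>c v + u\<close>. Once \<open>c\<close> is chosen, \<open>c'\<close> is forced to be
        the inverse of \<open>c\<close> times \<open>a\<close>, so only the condition on the
        translation part, collected in \<open>?W\<close>, remains.\<close>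
      let ?h = "\<lambda>(u, c, v). (affine_map R c u, affine_map R (inv c \<otimes> a) v)"
      have iC: "inv c \<in> C" if "c \<in> C" for c
        using subgroup.m_inv_closed[OF C that] m_inv_mult_of CR[OF that] by simp
      have mC: "c \<otimes> c' \<in> C" if "c \<in> C" "c' \<in> C" for c c'
        using subgroup.m_closed[OF C that] by simp
      have ii: "inv c \<otimes> c = \<one>" "c \<otimes> inv c = \<one>" if "c \<in> C" for c
        using CR[OF that] field_Units by auto
      have "inj_on ?h ?W"
      proof (rule inj_onI, unfold split_paired_all)
        fix u c v u' c' v' :: 'a
        assume *: "(u, c, v) \<in> ?W" "(u', c', v') \<in> ?W" "?h (u, c, v) = ?h (u', c', v')"
        then have "c = c'" "u = u'"
          using CR AR by (auto simp: affine_map_eq_iff)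
        moreover have "v = v'"
          using * \<open>c = c'\<close> CR[OF mC[OF iC a]] AR by (auto simp: affine_map_eq_iff)
        ultimately show "(u, c, v) = (u', c', v')"
          by simp
      qed
      moreover have "?h ` ?W = ?Q"
      proof
        show "?h ` ?W \<subseteq> ?Q"
        proof (rule image_subsetI, unfold split_paired_all)
          fix u c v assume "(u, c, v) \<in> ?W"
          then have *: "u \<in> A" "c \<in> C" "v \<in> A" "b = c \<otimes> v \<oplus> u"
            by auto
          have "c \<otimes> (inv c \<otimes> a) = a"
            using CR[OF *(2)] CR[OF iC[OF *(2)]] CR[OF a] ii[OF *(2)]
            by (simp add: m_assoc[symmetric])
          then have "affine_map R c u \<otimes>\<^bsub>?B\<^esub> affine_map R (inv c \<otimes> a) v = g"
            using mult_affine_map CR[OF *(2)] CR[OF mC[OF iC[OF *(2)] a]] AR * gab by simp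
          then show "?h (u, c, v) \<in> ?Q"
            using * S_iff mC[OF iC[OF *(2)] a] AR by auto
        qed
        show "?Q \<subseteq> ?h ` ?W"
        proof (rule subsetI, unfold split_paired_all)
          fix y1 y2 assume "(y1, y2) \<in> ?Q"
          then have y: "y1 \<in> S" "y2 \<in> S" and gy: "g = y1 \<otimes>\<^bsub>?B\<^esub> y2"
            by auto
          obtain c u c' v where y1: "y1 = affine_map R c u" "c \<in> C" "u \<in> A"
            and y2: "y2 = affine_map R c' v" "c' \<in> C" "v \<in> A"
            using y by (auto simp: S_def)
          have "affine_map R a b = affine_map R (c \<otimes> c') (c \<otimes> v \<oplus> u)"
            using gab gy mult_affine_map CR[OF y1(2)] CR[OF y2(2)] AR y1 y2 by simp
          then have ab: "a = c \<otimes> c'" "b = c \<otimes> v \<oplus> u"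
            using CR[OF a] b CR[OF y1(2)] CR[OF y2(2)] AR y1 y2
            by (simp_all add: affine_map_eq_iff)
          have "inv c \<otimes> a = c'"
            using CR[OF y1(2)] CR[OF y2(2)] CR[OF iC[OF y1(2)]] ii[OF y1(2)]
            by (simp add: ab m_assoc[symmetric])
          then have "?h (u, c, v) = (y1, y2)"
            using y1 y2 by simp
          moreover have "(u, c, v) \<in> ?W"
            using y1 y2 ab by simp
          ultimately show "(y1, y2) \<in> ?h ` ?W"
            by (rule image_eqI[of _ ?h "(u, c, v)" ?W, OF sym])
        qed
      qed
      ultimately have "card ?Q = card ?W"
        using card_image[of ?h ?W] by simp
      then show ?thesis
        using card_translated_factorizations[OF fin C A two b] by simp
    qed
    \<comment> \<open>Positivity keeps the truncated subtraction exact in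
      \<open>2 * (card A - 1) + 2 = 2 * card A\<close>.\<close>
    moreover have "card A > 0" if "b \<in> A"
      using that finA by (auto simp: card_gt_0_iff)
    ultimately show ?thesis
      unfolding split using finA by (auto simp: card_Diff_singleton_if)
  qed
  have "card (insert e S) = card A * card C + 1"
    using eS cardS finite_subset[OF SG finG] by simp
  then have "sum_set (?B\<lparr>carrier := G\<rparr>) (order R * card C) (card A * card C + 1) (2 * card A)
      (insert e S)"
    using B.subgroup_imp_group[OF sG] finG cardG SG eG count e_one
    by (auto simp: sum_set_def order_def)
  then show ?thesis
    unfolding G_def S_def e_def .
qed

end

theorem theorem7p3:
  fixes F :: "('a, 'b) ring_scheme" and q d :: nat
  assumes "primepow q"
    and "field F" and "order F = q"
    and "d \<ge> 2" and "d dvd q - 1"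
  shows "\<exists>T. sum_set (EA_semidirect_C F d) (q * d) (2 * q - 1) (4 * (q - 1) div d) T"
proof -
  interpret field F
    by fact
  interpret M: group "mult_of F"
    by (rule field_mult_group)
  \<comment> \<open>An infinite carrier would have order 0, so a positive order forces the field to
    be finite.\<close>
  have q: "q > 0"
    using primepow_gt_0_nat[OF assms(1)] .
  then have fin: "finite (carrier F)"
    using assms(3) by (metis order_gt_0_iff_finite)
  define C where "C = mult_subgroup F d"
  have C: "subgroup C (mult_of F)" "card C = d"
    using mult_subgroup_char[OF fin] assms unfolding C_def by auto
  have index: "card (rcosets\<^bsub>mult_of F\<^esub> C) * d = q - 1"
    using M.lagrange[OF C(1)] C(2) order_mult_of[OF fin] assms(3) by simp
  \<comment> \<open>Here \<open>d \<ge> 2\<close> enters: each coset of \<open>C\<close> has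
    \<open>d\<close> elements and must supply two of them.\<close>
  obtain A where A: "A \<subseteq> carrier (mult_of F)" "card A = 2 * card (rcosets\<^bsub>mult_of F\<^esub> C)"
    "\<And>z. z \<in> carrier (mult_of F) \<Longrightarrow> card (A \<inter> (C #>\<^bsub>mult_of F\<^esub> z)) = 2"
    using M.ex_multi_transversal[OF _ C(1), of 2] fin C(2) assms(4) by auto
  \<comment> \<open>With \<open>m\<close> cosets of \<open>C\<close>, the left side is
    \<open>2 m d + 1 = 2 (q - 1) + 1\<close>; since \<open>q > 0\<close>, this equals
    \<open>2 * q - 1\<close> also in the natural numbers.\<close>
  have "card A * card C + 1 = 2 * q - 1"
    using index A(2) C(2) q by simp
  \<comment> \<open>This shows that the division by \<open>d\<close> in the claimed parameter is
    exact.\<close>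
  moreover have "4 * (q - 1) = 2 * card A * d"
    using index A(2) by simp
  then have "2 * card A = 4 * (q - 1) div d"
    using assms(4) by (metis nonzero_mult_div_cancel_right not_numeral_le_zero)
  moreover have "EA_semidirect_C F d =
      BijGroup (carrier F)\<lparr>carrier := {affine_map F a b | a b. a \<in> C \<and> b \<in> carrier F}\<rparr>"
    by (simp add: EA_semidirect_C_def Aff_def C_def)
  ultimately show ?thesis
    using sum_set_affine_maps[OF fin C(1), of A] A C(2) assms(3) by auto
qed

end
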